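(* Let $n\ge 1$ be an integer and let $x\in\mathbb{R}$ with $x\neq \pm 1$, $x\neq 0$, and such that the power $\left(\frac1x\right)^{\odot n}$ is defined. Then $$\left(\frac{1}{x}\right)^{\odot n}=\frac{v_n(x)}{u_n(x)},$$ where $$(u_n(x))_{n=0}^\infty=\mathcal W(1,x,2x,1+x^2),\qquad (v_n(x))_{n=0}^\infty=\mathcal W(0,1,2x,1+x^2).$$
   Context: For real $a,b$ with $ab\neq 1$, put $a\odot b=\frac{a+b}{1-ab}$; this is a (partial) operation, undefined when $ab=1$. The $n$-th power with respect to $\odot$ is given by $a^{\odot 1}=a$ and $a^{\odot n}=a\odot a^{\odot (n-1)}$ for $n\ge 2$; it is defined when all the products occurring in this recursion are defined. $\mathcal W(\alpha,\beta,p,q)$ denotes the linear recurrent sequence $(a_n)_{n=0}^{\infty}$ of order 2 with $a_0=\alpha$, $a_1=\beta$, and $a_n=p\,a_{n-1}-q\,a_{n-2}$ for all $n\ge 2$. *)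

theory Defs
  imports Complex_Main
begin

text \<open>The partial operation: \<open>None\<close> stands for ``undefined''.\<close>

definition odot :: "real \<Rightarrow> real \<Rightarrow> real option" where
  "odot a b = (if a * b \<noteq> 1 then Some ((a + b) / (1 - a * b)) else None)"

text \<open>The power is defined only if every product occurring in the recursion is, hence the
  propagation of \<open>None\<close>. Powers start at exponent 1, so exponent 0 is left undefined.\<close>

fun odot_power :: "real \<Rightarrow> nat \<Rightarrow> real option" where
  "odot_power a 0 = None"
| "odot_power a (Suc 0) = Some a"
| "odot_power a (Suc (Suc n)) = Option.bind (odot_power a (Suc n)) (odot a)"

fun lin_rec :: "real \<Rightarrow> real \<Rightarrow> real \<Rightarrow> real \<Rightarrow> nat \<Rightarrow> real" where
  "lin_rec \<alpha> \<beta> p q 0 = \<alpha>"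
| "lin_rec \<alpha> \<beta> p q (Suc 0) = \<beta>"
| "lin_rec \<alpha> \<beta> p q (Suc (Suc n)) = p * lin_rec \<alpha> \<beta> p q (Suc n) - q * lin_rec \<alpha> \<beta> p q n"

end

theory Submission
  imports Defs
begin

text \<open>The sequences are the real and imaginary parts of \<open>(x + \<i>)\<^sup>n = u\<^sub>n + \<i> v\<^sub>n\<close>, so multiplying by
  \<open>x + \<i>\<close> gives \<open>u\<^sub>n\<^sub>+\<^sub>1 = x u\<^sub>n - v\<^sub>n\<close> and \<open>v\<^sub>n\<^sub>+\<^sub>1 = u\<^sub>n + x v\<^sub>n\<close>. The operation \<open>\<odot>\<close> is the addition law
  of the tangent, the quotient of imaginary and real part, hence adds one factor at a time.\<close>

lemma lin_rec_Suc:
  fixes x :: real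
  defines "u \<equiv> lin_rec 1 x (2 * x) (1 + x\<^sup>2)" and "v \<equiv> lin_rec 0 1 (2 * x) (1 + x\<^sup>2)"
  shows "u (Suc n) = x * u n - v n \<and> v (Suc n) = u n + x * v n"
proof (induction n)
  case 0
  show ?case by (simp add: u_def v_def)
next
  case (Suc n)
  have "u (Suc (Suc n)) = 2 * x * u (Suc n) - (1 + x\<^sup>2) * u n"
    and "v (Suc (Suc n)) = 2 * x * v (Suc n) - (1 + x\<^sup>2) * v n"
    by (simp_all add: u_def v_def)
  \<comment> \<open>Once the induction hypothesis removes index \<open>Suc n\<close>, polynomial
    identities in \<open>x\<close>, \<open>u n\<close>, \<open>v n\<close> remain.\<close>
  then show ?case
    by (simp add: Suc.IH) (simp add: algebra_simps power2_eq_square)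
qed

text \<open>Since 1 - (1/x)(v/u) = (x u - v)/(x u), the product is defined exactly when the new
  denominator is nonzero; this carries \<open>?u n \<noteq> 0\<close> through the induction.\<close>

lemma odot_inverse_quotient:
  fixes x u v :: real
  assumes "x \<noteq> 0" "u \<noteq> 0" "odot (1 / x) (v / u) \<noteq> None"
  shows "x * u - v \<noteq> 0 \<and> odot (1 / x) (v / u) = Some ((u + x * v) / (x * u - v))"
proof -
  have "1 / x * (v / u) \<noteq> 1"
    using assms(3) by (auto simp: odot_def)
  moreover from this have "x * u - v \<noteq> 0"
    using assms by (auto simp: field_simps)
  ultimately show ?thesis
    using assms by (simp add: odot_def divide_simps)
qed

theorem theorem1:
  fixes x :: real and n :: nat
  assumes "n \<ge> 1"
    and "x \<noteq> 1" and "x \<noteq> -1" and "x \<noteq> 0"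
    and "odot_power (1 / x) n \<noteq> None"
  shows "lin_rec 1 x (2 * x) (1 + x\<^sup>2) n \<noteq> 0 \<and>
    odot_power (1 / x) n =
      Some (lin_rec 0 1 (2 * x) (1 + x\<^sup>2) n / lin_rec 1 x (2 * x) (1 + x\<^sup>2) n)"
  using assms(1,5)
proof (induction n rule: nat_induct_at_least)
  case base
  show ?case using \<open>x \<noteq> 0\<close> by simp
next
  case (Suc n)
  let ?u = "lin_rec 1 x (2 * x) (1 + x\<^sup>2)" and ?v = "lin_rec 0 1 (2 * x) (1 + x\<^sup>2)"
  \<comment> \<open>This fails at exponent 0, where the right side would be \<open>None\<close>;
    hence the use of \<open>n \<ge> 1\<close>.\<close>
  have step: "odot_power (1 / x) (Suc n) = Option.bind (odot_power (1 / x) n) (odot (1 / x))"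
    using Suc.hyps by (cases n) auto
  with Suc.prems have "odot_power (1 / x) n \<noteq> None"
    by (cases "odot_power (1 / x) n") auto
  with Suc.IH have "?u n \<noteq> 0" and "odot_power (1 / x) n = Some (?v n / ?u n)"
    by auto
  with step have "odot_power (1 / x) (Suc n) = odot (1 / x) (?v n / ?u n)"
    by simp
  with odot_inverse_quotient[OF \<open>x \<noteq> 0\<close> \<open>?u n \<noteq> 0\<close>, of "?v n"] Suc.prems lin_rec_Suc[of x n]
  show ?case by (simp del: lin_rec.simps odot_power.simps)
qed

end
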